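(* Let $\Phi$ be a balanced relative simplicial complex of dimension $d$ with coloring $\kappa$, and let $\mathfrak{G}\subseteq\mathrm{Aut}(\Phi)$. Then the flag quasisymmetric class function $F(\Phi,\mathfrak{G},\mathbf{x})$ is a quasisymmetric class function, and it is $M$-increasing.
   Context: A balanced relative simplicial complex of dimension $d$ on a finite vertex set $V$ is a nonempty collection $\Phi$ of subsets of $V$ with a function $\kappa:V\to[d+1]$ such that: (1) if $\rho\subseteq\sigma\subseteq\tau$ and $\rho,\tau\in\Phi$ then $\sigma\in\Phi$; (2) every $\rho\in\Phi$ is contained in some $\sigma\in\Phi$ with $|\sigma|=d+1$; (3) for every $\rho\in\Phi$, $\kappa(\rho)=\{\kappa(v):v\in\rho\}$ has $|\rho|$ elements. An automorphism of $\Phi$ is a bijection $\mathfrak{g}:V\to V$ with $\kappa(\mathfrak{g}v)=\kappa(v)$ for all $v$ and $\mathfrak{g}\sigma\in\Phi$ for all $\sigma\in\Phi$; $\mathrm{Aut}(\Phi)$ is the group of these. For $S=\{s_1<\dots<s_k\}\subseteq[d+1]$, $\alpha(S)=(s_1,s_2-s_1,\dots,s_k-s_{k-1},d+2-s_k)$, a composition of $d+2$. With $M_\alpha$ the monomial quasisymmetric function, the flag quasisymmetric class function is defined for $\mathfrak{g}\in\mathfrak{G}$ by $F(\Phi,\mathfrak{G},\mathbf{x};\mathfrak{g})=\sum_{\sigma\in\Phi:\ \mathfrak{g}\sigma=\sigma}M_{\alpha(\kappa(\sigma))}$. A quasisymmetric class function is a function from $\mathfrak{G}$ to quasisymmetric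 functions constant on conjugacy classes. Writing $F=\sum_\alpha f_\alpha M_\alpha$ with $f_\alpha$ complex class functions, $F$ is $M$-increasing if $f_\alpha\le_{\mathfrak{G}}f_\beta$ whenever $\beta$ refines $\alpha$, where for effective characters (nonnegative integer combinations of irreducible characters) $\chi\le_{\mathfrak{G}}\psi$ means $\psi-\chi$ is effective. *)

theory Defs
  imports
    "HOL-Algebra.Bij"
    "HOL-Library.Poly_Mapping"
    "Jordan_Normal_Form.VS_Connect"
begin

section \<open>Balanced relative simplicial complexes\<close>

text \<open>
  The dimension is an integer, so that the complex \<open>{{}}\<close> of dimension \<open>-1\<close> is covered.
  Bounds \<open>d < -1\<close> are excluded by \<open>nonempty\<close> and \<open>pure\<close>.
\<close>

locale balanced_relative_complex =
  fixes V :: "'v set" and \<Phi> :: "'v set set" and \<kappa> :: "'v \<Rightarrow> nat" and d :: int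
  assumes finite_V: "finite V"
    and faces: "\<Phi> \<subseteq> Pow V"
    and nonempty: "\<Phi> \<noteq> {}"
    and coloring: "\<kappa> \<in> V \<rightarrow> {1..nat (d + 1)}"
    and convex: "\<lbrakk>\<rho> \<subseteq> \<sigma>; \<sigma> \<subseteq> \<tau>; \<rho> \<in> \<Phi>; \<tau> \<in> \<Phi>\<rbrakk> \<Longrightarrow> \<sigma> \<in> \<Phi>"
    and pure: "\<rho> \<in> \<Phi> \<Longrightarrow> \<exists>\<sigma>\<in>\<Phi>. \<rho> \<subseteq> \<sigma> \<and> int (card \<sigma>) = d + 1"
    and balanced: "\<rho> \<in> \<Phi> \<Longrightarrow> card (\<kappa> ` \<rho>) = card \<rho>"

text \<open>As in \<^const>\<open>BijGroup\<close>, permutations of \<open>V\<close> are represented by functions that are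
  extensional on \<open>V\<close>, so that each automorphism occurs exactly once.\<close>

definition complex_auto :: "'v set \<Rightarrow> 'v set set \<Rightarrow> ('v \<Rightarrow> nat) \<Rightarrow> ('v \<Rightarrow> 'v) set" where
  "complex_auto V \<Phi> \<kappa> =
     {g \<in> Bij V. (\<forall>v\<in>V. \<kappa> (g v) = \<kappa> v) \<and> (\<forall>\<sigma>\<in>\<Phi>. g ` \<sigma> \<in> \<Phi>)}"

definition complex_AutoGroup :: "'v set \<Rightarrow> 'v set set \<Rightarrow> ('v \<Rightarrow> nat) \<Rightarrow> ('v \<Rightarrow> 'v) monoid" where
  "complex_AutoGroup V \<Phi> \<kappa> = (BijGroup V)\<lparr>carrier := complex_auto V \<Phi> \<kappa>\<rparr>"

lemma (in balanced_relative_complex) group_complex_AutoGroup: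
  "group (complex_AutoGroup V \<Phi> \<kappa>)"
proof -
  interpret B: group "BijGroup V" by (rule group_BijGroup)
  let ?A = "complex_auto V \<Phi> \<kappa>"
  have mem: "x \<in> V" if "\<sigma> \<in> \<Phi>" "x \<in> \<sigma>" for \<sigma> x
    using faces that by auto
  have "subgroup ?A (BijGroup V)"
  proof (rule B.subgroupI)
    show "?A \<subseteq> carrier (BijGroup V)"
      by (auto simp: complex_auto_def BijGroup_def)
    have "(\<lambda>x\<in>V. x) ` \<sigma> = \<sigma>" if "\<sigma> \<in> \<Phi>" for \<sigma>
    proof -
      have "(\<lambda>x\<in>V. x) ` \<sigma> = (\<lambda>x. x) ` \<sigma>"
        by (rule image_cong) (use mem[OF that] in auto)
      then show ?thesis by simp
    qed
    then have "(\<lambda>x\<in>V. x) \<in> ?A"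
      using id_Bij[of V] by (simp add: complex_auto_def)
    then show "?A \<noteq> {}" by blast
  next
    fix g assume g: "g \<in> ?A"
    then have gB: "g \<in> Bij V" and gk: "\<And>v. v \<in> V \<Longrightarrow> \<kappa> (g v) = \<kappa> v"
      and gF: "(`) g ` \<Phi> \<subseteq> \<Phi>"
      by (auto simp: complex_auto_def)
    have bij: "bij_betw g V V" using gB by (simp add: Bij_def)
    have "inj_on ((`) g) \<Phi>"
      using inj_on_image_Pow[OF bij_betw_imp_inj_on[OF bij]] faces by (rule inj_on_subset)
    moreover have "finite \<Phi>"
      using finite_V faces finite_subset by blast
    ultimately have onto: "(`) g ` \<Phi> = \<Phi>"
      using gF by (simp add: endo_inj_surj)
    let ?h = "restrict (inv_into V g) V"
    have inV: "inv_into V g v \<in> V" "g (inv_into V g v) = v" if "v \<in> V" for v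
      using bij that by (auto simp: bij_betw_def intro: inv_into_into f_inv_into_f)
    have "?h ` \<sigma> \<in> \<Phi>" if "\<sigma> \<in> \<Phi>" for \<sigma>
    proof -
      have "\<sigma> \<in> (`) g ` \<Phi>" using onto that by simp
      then obtain \<tau> where \<tau>: "\<tau> \<in> \<Phi>" "\<sigma> = g ` \<tau>" by (elim imageE)
      have "?h (g x) = x" if "x \<in> \<tau>" for x
        using bij_betw_inv_into_left[OF bij mem[OF \<tau>(1) that]]
          bij_betwE[OF bij] mem[OF \<tau>(1) that] by simp
      then have "(\<lambda>x. ?h (g x)) ` \<tau> = (\<lambda>x. x) ` \<tau>" by (rule image_cong[OF refl])
      then have "?h ` \<sigma> = \<tau>" unfolding \<tau>(2) by (simp only: image_image image_ident)
      then show ?thesis using \<tau>(1) by simp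
    qed
    moreover have "\<kappa> (?h v) = \<kappa> v" if "v \<in> V" for v
      using gk[of "inv_into V g v"] inV[OF that] that by simp
    ultimately show "inv\<^bsub>BijGroup V\<^esub> g \<in> ?A"
      using restrict_inv_into_Bij[OF gB] by (simp add: complex_auto_def inv_BijGroup[OF gB])
  next
    fix g h assume gh: "g \<in> ?A" "h \<in> ?A"
    then have B: "g \<in> Bij V" "h \<in> Bij V" by (auto simp: complex_auto_def)
    have "compose V g h ` \<sigma> \<in> \<Phi>" if "\<sigma> \<in> \<Phi>" for \<sigma>
    proof -
      have "compose V g h ` \<sigma> = (\<lambda>x. g (h x)) ` \<sigma>"
        by (rule image_cong) (use mem[OF that] in \<open>auto simp: compose_eq\<close>)
      then have "compose V g h ` \<sigma> = g ` (h ` \<sigma>)" by (simp add: image_image)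
      then show ?thesis using gh that unfolding complex_auto_def by simp
    qed
    moreover have "\<kappa> (compose V g h v) = \<kappa> v" if "v \<in> V" for v
    proof -
      have "h v \<in> V" using Bij_imp_funcset[OF B(2)] that by blast
      then show ?thesis using gh that unfolding complex_auto_def by (simp add: compose_eq)
    qed
    ultimately have "compose V g h \<in> ?A"
      using compose_Bij[OF B] by (simp add: complex_auto_def)
    then show "g \<otimes>\<^bsub>BijGroup V\<^esub> h \<in> ?A"
      using B by (simp add: BijGroup_def)
  qed
  then show ?thesis
    unfolding complex_AutoGroup_def by (rule subgroup.subgroup_is_group) (rule group_BijGroup)
qed


section \<open>Compositions\<close>

definition composition :: "nat list \<Rightarrow> bool" where
  "composition \<alpha> \<longleftrightarrow> (\<forall>a\<in>set \<alpha>. 0 < a)"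

definition refines :: "nat list \<Rightarrow> nat list \<Rightarrow> bool" where
  "refines \<beta> \<alpha> \<longleftrightarrow> (\<exists>\<beta>s. concat \<beta>s = \<beta> \<and> map sum_list \<beta>s = \<alpha>)"

text \<open>\<open>comp_of_set n {s\<^sub>1 < \<dots> < s\<^sub>k} = [s\<^sub>1, s\<^sub>2 - s\<^sub>1, \<dots>, s\<^sub>k - s\<^sub>k\<^sub>-\<^sub>1, n - s\<^sub>k]\<close>,
  which is \<open>[n]\<close> for the empty set.\<close>

definition comp_of_set :: "nat \<Rightarrow> nat set \<Rightarrow> nat list" where
  "comp_of_set n S =
     (let ss = sorted_list_of_set S in map2 (\<lambda>s t. t - s) (0 # ss) (ss @ [n]))"


section \<open>Quasisymmetric functions\<close>

text \<open>A formal power series in countably many variables \<open>x\<^sub>0, x\<^sub>1, \<dots>\<close> is given by its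
  coefficient function, a monomial being a finitely supported exponent vector.\<close>

type_synonym power_series = "(nat \<Rightarrow>\<^sub>0 nat) \<Rightarrow> complex"

definition monomial :: "nat list \<Rightarrow> nat list \<Rightarrow> (nat \<Rightarrow>\<^sub>0 nat)" where
  "monomial is \<alpha> = (\<Sum>(i, a)\<leftarrow>zip is \<alpha>. Poly_Mapping.single i a)"

definition total_degree :: "(nat \<Rightarrow>\<^sub>0 nat) \<Rightarrow> nat" where
  "total_degree m = (\<Sum>i\<in>Poly_Mapping.keys m. Poly_Mapping.lookup m i)"

definition quasisymmetric :: "power_series \<Rightarrow> bool" where
  "quasisymmetric f \<longleftrightarrow>
     (\<exists>N. \<forall>m. f m \<noteq> 0 \<longrightarrow> total_degree m \<le> N) \<and>
     (\<forall>\<alpha> is js. composition \<alpha> \<and>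
        sorted_wrt (<) is \<and> sorted_wrt (<) js \<and>
        length is = length \<alpha> \<and> length js = length \<alpha>
        \<longrightarrow> f (monomial is \<alpha>) = f (monomial js \<alpha>))"

text \<open>\<open>M\<^sub>\<alpha>\<close> is the formal sum of \<open>x\<^bsub>i\<^sub>1\<^esub>\<^bsup>\<alpha>\<^sub>1\<^esup> \<dots> x\<^bsub>i\<^sub>k\<^esub>\<^bsup>\<alpha>\<^sub>k\<^esup>\<close> over all \<open>i\<^sub>1 < \<dots> < i\<^sub>k\<close>, so
  its coefficient at \<open>m\<close> counts the index sequences that yield \<open>m\<close>.\<close>

definition M_qsym :: "nat list \<Rightarrow> power_series" where
  "M_qsym \<alpha> m =
     of_nat (card {is. sorted_wrt (<) is \<and> length is = length \<alpha> \<and> monomial is \<alpha> = m})"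


section \<open>Characters\<close>

definition mat_trace :: "'a::comm_monoid_add mat \<Rightarrow> 'a" where
  "mat_trace A = (\<Sum>i<dim_row A. A $$ (i, i))"

text \<open>A matrix representation is a homomorphism into \<open>GL\<^sub>n(\<complex>)\<close>, the group of units of
  the matrix ring.\<close>

definition representation ::
    "('g, 'b) monoid_scheme \<Rightarrow> nat \<Rightarrow> ('g \<Rightarrow> complex mat) \<Rightarrow> bool" where
  "representation G n \<rho> \<longleftrightarrow> \<rho> \<in> hom G (units_of (ring_mat TYPE(complex) n ()))"

definition irreducible_representation ::
    "('g, 'b) monoid_scheme \<Rightarrow> nat \<Rightarrow> ('g \<Rightarrow> complex mat) \<Rightarrow> bool" where
  "irreducible_representation G n \<rho> \<longleftrightarrow>
     representation G n \<rho> \<and> 0 < n \<and>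
     (\<forall>W. VectorSpace.subspace class_ring W (module_vec TYPE(complex) n) \<and>
          (\<forall>g\<in>carrier G. \<forall>w\<in>W. \<rho> g *\<^sub>v w \<in> W)
          \<longrightarrow> W = {0\<^sub>v n} \<or> W = carrier_vec n)"

definition irreducible_character ::
    "('g, 'b) monoid_scheme \<Rightarrow> ('g \<Rightarrow> complex) \<Rightarrow> bool" where
  "irreducible_character G \<chi> \<longleftrightarrow>
     (\<exists>n \<rho>. irreducible_representation G n \<rho> \<and> (\<forall>g\<in>carrier G. \<chi> g = mat_trace (\<rho> g)))"

definition effective :: "('g, 'b) monoid_scheme \<Rightarrow> ('g \<Rightarrow> complex) \<Rightarrow> bool" where
  "effective G \<chi> \<longleftrightarrow>
     (\<exists>A (c :: ('g \<Rightarrow> complex) \<Rightarrow> nat). finite A \<and> (\<forall>\<psi>\<in>A. irreducible_character G \<psi>) \<and>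
        (\<forall>g\<in>carrier G. \<chi> g = (\<Sum>\<psi>\<in>A. of_nat (c \<psi>) * \<psi> g)))"

definition character_le ::
    "('g, 'b) monoid_scheme \<Rightarrow> ('g \<Rightarrow> complex) \<Rightarrow> ('g \<Rightarrow> complex) \<Rightarrow> bool" where
  "character_le G \<chi> \<psi> \<longleftrightarrow>
     effective G \<chi> \<and> effective G \<psi> \<and> effective G (\<lambda>g. \<psi> g - \<chi> g)"

definition class_function :: "('g, 'b) monoid_scheme \<Rightarrow> ('g \<Rightarrow> 'c) \<Rightarrow> bool" where
  "class_function G f \<longleftrightarrow>
     (\<forall>g\<in>carrier G. \<forall>h\<in>carrier G. f (h \<otimes>\<^bsub>G\<^esub> g \<otimes>\<^bsub>G\<^esub> inv\<^bsub>G\<^esub> h) = f g)"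


section \<open>Quasisymmetric class functions\<close>

definition qsym_class_function ::
    "('g, 'b) monoid_scheme \<Rightarrow> ('g \<Rightarrow> power_series) \<Rightarrow> bool" where
  "qsym_class_function G F \<longleftrightarrow>
     (\<forall>g\<in>carrier G. quasisymmetric (F g)) \<and> class_function G F"

text \<open>The family \<open>f\<close> in an expansion \<open>F = \<Sum>\<^sub>\<alpha> f\<^sub>\<alpha> M\<^sub>\<alpha>\<close> is unique on compositions and
  group elements, since the \<open>M\<^sub>\<alpha>\<close> form a basis of the quasisymmetric functions.\<close>

definition M_expansion ::
    "('g, 'b) monoid_scheme \<Rightarrow> ('g \<Rightarrow> power_series) \<Rightarrow> (nat list \<Rightarrow> 'g \<Rightarrow> complex) \<Rightarrow> bool" where
  "M_expansion G F f \<longleftrightarrow>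
     (\<forall>\<alpha>. composition \<alpha> \<longrightarrow> class_function G (f \<alpha>)) \<and>
     (\<forall>g\<in>carrier G. finite {\<alpha>. composition \<alpha> \<and> f \<alpha> g \<noteq> 0} \<and>
        F g = (\<lambda>m. \<Sum>\<alpha> | composition \<alpha> \<and> f \<alpha> g \<noteq> 0. f \<alpha> g * M_qsym \<alpha> m))"

definition M_increasing :: "('g, 'b) monoid_scheme \<Rightarrow> ('g \<Rightarrow> power_series) \<Rightarrow> bool" where
  "M_increasing G F \<longleftrightarrow>
     (\<exists>f. M_expansion G F f \<and>
        (\<forall>\<alpha> \<beta>. composition \<alpha> \<and> composition \<beta> \<and> refines \<beta> \<alpha>
           \<longrightarrow> character_le G (f \<alpha>) (f \<beta>)))"

definition flag_qsym ::
    "'v set set \<Rightarrow> ('v \<Rightarrow> nat) \<Rightarrow> int \<Rightarrow> ('v \<Rightarrow> 'v) \<Rightarrow> power_series" where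
  "flag_qsym \<Phi> \<kappa> d g =
     (\<lambda>m. \<Sum>\<sigma> | \<sigma> \<in> \<Phi> \<and> g ` \<sigma> = \<sigma>. M_qsym (comp_of_set (nat (d + 2)) (\<kappa> ` \<sigma>)) m)"

end

theory Submission
  imports Defs
begin

text \<open>
  The coefficient \<open>f\<^sub>\<alpha>\<close> of \<open>M\<^sub>\<alpha>\<close> is the permutation character on the faces with color set \<open>S\<close>,
  where \<open>\<alpha> = \<alpha>(S)\<close>. If \<open>\<beta> = \<alpha>(T)\<close> refines \<open>\<alpha>\<close> then \<open>S \<subseteq> T\<close>, and every face of color set \<open>T\<close>
  contains exactly one subset of color set \<open>S\<close>. Since all faces lie in facets, and by convexity, this
  restriction is an equivariant surjection from an invariant set of faces of color set \<open>T\<close> onto the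
  faces of color set \<open>S\<close>. Hence \<open>f\<^sub>\<beta> - f\<^sub>\<alpha>\<close> is the character of the kernel of an equivariant map of
  permutation modules. The trace of any representation is a sum of irreducible characters
  by induction on the dimension: in a basis adapted to an invariant subspace the representation is
  block triangular, so no complete reducibility is needed.
\<close>

section \<open>Traces of representations\<close>

text \<open>A basis of \<open>W\<close>, extended to a basis of the whole space, supplies the
  columns of \<open>P\<close>; \<open>Q\<close> is the inverse of \<open>P\<close>, and
  \<open>k\<close> is the size of the basis of \<open>W\<close>. No bound on \<open>k\<close> is
  recorded: the inequalities used later come from \<open>W\<close> being neither zero nor the whole
  space.\<close>

lemma (in vec_space) subspace_coordinates:
  assumes W: "subspace class_ring W V"
  obtains k P Q where "P \<in> carrier_mat n n" "Q \<in> carrier_mat n n"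
    "P * Q = 1\<^sub>m n" "Q * P = 1\<^sub>m n"
    "W = {w \<in> carrier_vec n. \<forall>i. k \<le> i \<and> i < n \<longrightarrow> (Q *\<^sub>v w) $ i = 0}"
proof -
  have sub: "submodule class_ring W V" using W by simp
  have Wc: "W \<subseteq> carrier_vec n" using submodule.subset[OF sub] by simp
  have li0: "lin_indpt {}" by (simp add: lin_dep_def)
  have "\<exists>A. finite A \<and> maximal A (\<lambda>S. S \<subseteq> W \<and> lin_indpt S)"
  proof (rule maximal_exists)
    show "finite S \<and> card S \<le> n" if "S \<subseteq> W \<and> lin_indpt S" for S
      using li_le_dim[OF fin_dim, of S] that Wc by (auto simp: dim_is_n)
    show "{} \<subseteq> W \<and> lin_indpt {}" using li0 by simp
  qed
  then obtain A where finA: "finite A" and maxA: "maximal A (\<lambda>S. S \<subseteq> W \<and> lin_indpt S)"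
    by blast
  have AW: "A \<subseteq> W" and liA: "lin_indpt A" using maxA by (auto simp: maximal_def)
  have Ac: "A \<subseteq> carrier_vec n" using AW Wc by blast
  have "W \<subseteq> span A"
  proof
    fix v assume v: "v \<in> W"
    show "v \<in> span A"
    proof (rule ccontr)
      assume n: "v \<notin> span A"
      then have nA: "v \<notin> A" using in_own_span[of A] Ac by auto
      then have "lin_indpt (A \<union> {v})"
        using lin_dep_iff_in_span[of A v] Ac liA v Wc n by auto
      then have "A \<union> {v} = A"
        using maxA AW v unfolding maximal_def by blast
      then show False using nA by blast
    qed
  qed
  moreover have "span A \<subseteq> W" using span_is_subset[OF AW sub] .
  ultimately have spanA: "span A = W" by blast
  let ?U = "set (unit_vecs n) :: 'a vec set"
  have AU: "A \<subseteq> span ?U" using Ac by (simp add: span_unit_vecs_is_carrier)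
  \<comment> \<open>Steinitz exchange against the unit vectors bounds \<open>card C\<close> by
    \<open>n - card A\<close>, while a spanning set has at least \<open>n\<close> elements. So
    \<open>A \<union> C\<close> has exactly \<open>n\<close> elements, and the matrix
    \<open>P\<close> formed from it is square.\<close>
  have "\<exists>C. finite C \<and> C \<subseteq> carrier_vec n \<and> C \<subseteq> span ?U \<and> C \<inter> A = {} \<and>
      int (card C) \<le> int (card ?U) - int (card A) \<and> span (A \<union> C) = span ?U"
    by (rule replacement[OF finA finite_set _ liA AU]) (rule unit_vecs_carrier)
  then obtain C where C: "finite C" "C \<subseteq> carrier_vec n" "C \<inter> A = {}"
      "int (card C) \<le> int (card ?U) - int (card A)" "span (A \<union> C) = carrier_vec n"
    unfolding span_unit_vecs_is_carrier module_vec_simps by blast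
  have AC: "A \<union> C \<subseteq> carrier_vec n" "finite (A \<union> C)" using C Ac finA by auto
  have "card (A \<union> C) \<ge> n" using gen_ge_dim[of "A \<union> C"] AC C by (simp add: dim_is_n)
  moreover have "card (A \<union> C) = card A + card C" using C finA by (subst card_Un_disjoint) auto
  moreover have "card ?U = n" using distinct_card[OF unit_vecs_distinct] by simp
  ultimately have card: "card (A \<union> C) = n" using C by linarith
  obtain as where as: "set as = A" "distinct as" using finite_distinct_list[OF finA] by blast
  obtain cs where cs: "set cs = C" "distinct cs" using finite_distinct_list[OF C(1)] by blast
  let ?k = "length as"
  define vs where "vs = as @ cs"
  have vs: "set vs = A \<union> C" "distinct vs" using as cs C by (auto simp: vs_def)
  have len: "length vs = n" using distinct_card[OF vs(2)] card vs(1) by simp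
  define P where "P = mat_of_cols n vs"
  have P: "P \<in> carrier_mat n n" using mat_of_cols_carrier(1)[of n vs] len by (simp add: P_def)
  have vsc: "set vs \<subseteq> carrier_vec n" using vs AC by simp
  have lc: "lincomb_list c ws = mat_of_cols n ws *\<^sub>v vec (length ws) c"
    if "set ws \<subseteq> carrier_vec n" for c ws
    by (rule lincomb_list_as_mat_mult) (use that carrier_vecD in blast)
  have "\<exists>c. P *\<^sub>v vec n c = v" if "v \<in> carrier_vec n" for v
  proof -
    have "v \<in> span_list vs" using span_list_as_span[OF vsc] vs C that by simp
    then show ?thesis using lc[OF vsc] len by (auto simp: span_list_def P_def)
  qed
  then obtain c where c: "P *\<^sub>v vec n (c v) = v" if "v \<in> carrier_vec n" for v by metis
  \<comment> \<open>Column \<open>j\<close> of \<open>Q\<close> is a preimage of the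
    \<open>j\<close>-th unit vector under \<open>P\<close>; it exists because the columns of
    \<open>P\<close> span. This makes \<open>Q\<close> a right inverse, which for square matrices is
    also a left inverse.\<close>
  define Q where "Q = mat_of_cols n (map (\<lambda>j. vec n (c (unit_vec n j))) [0..<n])"
  have Q: "Q \<in> carrier_mat n n" 
    using mat_of_cols_carrier(1)[of n "map (\<lambda>j. vec n (c (unit_vec n j))) [0..<n]"]
    by (simp add: Q_def)
  have colQ: "col Q j = vec n (c (unit_vec n j))" if "j < n" for j
    using that by (simp add: Q_def col_mat_of_cols)
  have PQ: "P * Q = 1\<^sub>m n"
  proof (rule mat_col_eqI)
    fix j assume "j < dim_col (1\<^sub>m n :: 'a mat)"
    then have j: "j < n" by simp
    show "col (P * Q) j = col (1\<^sub>m n) j"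
      using j P Q col_mult2[OF P Q j] colQ[OF j] c by simp
  qed (use P Q in auto)
  have QP: "Q * P = 1\<^sub>m n" by (rule mat_mult_left_right_inverse[OF P Q PQ])
  show ?thesis
  proof (rule that[OF P Q PQ QP, of ?k], intro equalityI subsetI CollectI conjI allI impI)
    fix w assume w: "w \<in> W"
    then show "w \<in> carrier_vec n" using Wc by blast
    fix i assume i: "?k \<le> i \<and> i < n"
    have "w \<in> span_list as" using span_list_as_span[of as] as spanA w Ac by simp
    then obtain a where a: "w = mat_of_cols n as *\<^sub>v vec ?k a"
      using lc[of as] as Ac by (auto simp: span_list_def)
    \<comment> \<open>The coefficients of \<open>w\<close> over \<open>as\<close>, padded with
      zeros, are its coordinates in the full basis.\<close>
    define b where "b = vec n (\<lambda>j. if j < ?k then a j else 0)"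
    have "w = P *\<^sub>v b"
    proof (rule eq_vecI)
      fix l assume "l < dim_vec (P *\<^sub>v b)"
      then have l: "l < n" using P by simp
      have "(P *\<^sub>v b) $ l = (\<Sum>j<n. (vs ! j) $ l * b $ j)"
        using l len by (simp add: P_def scalar_prod_def b_def mat_of_cols_def lessThan_atLeast0)
      also have "\<dots> = (\<Sum>j<?k. (vs ! j) $ l * b $ j)"
        by (rule sum.mono_neutral_right) (use len in \<open>auto simp: b_def vs_def\<close>)
      also have "\<dots> = (\<Sum>j<?k. (as ! j) $ l * a j)"
        by (rule sum.cong) (use len in \<open>auto simp: b_def vs_def nth_append\<close>)
      also have "\<dots> = w $ l"
        using l by (simp add: a scalar_prod_def mat_of_cols_def lessThan_atLeast0)
      finally show "w $ l = (P *\<^sub>v b) $ l" by simp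
    qed (use P a in auto)
    then have "Q *\<^sub>v w = (Q * P) *\<^sub>v b"
      using P Q by (simp add: assoc_mult_mat_vec[of _ n n _ n] b_def)
    then have "Q *\<^sub>v w = b" by (simp add: QP b_def)
    then show "(Q *\<^sub>v w) $ i = 0" using i by (simp add: b_def)
  next
    fix w assume w: "w \<in> {w \<in> carrier_vec n. \<forall>i. ?k \<le> i \<and> i < n \<longrightarrow> (Q *\<^sub>v w) $ i = 0}"
    define b where "b = Q *\<^sub>v w"
    have b: "b \<in> carrier_vec n" "\<And>j. ?k \<le> j \<Longrightarrow> j < n \<Longrightarrow> b $ j = 0"
      using w Q by (auto simp: b_def)
    have wP: "w = P *\<^sub>v b"
      using w P Q by (simp add: b_def assoc_mult_mat_vec[of _ n n _ n, symmetric] PQ)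
    have "w = mat_of_cols n as *\<^sub>v vec ?k (\<lambda>j. b $ j)"
    proof (rule eq_vecI)
      fix l assume "l < dim_vec (mat_of_cols n as *\<^sub>v vec ?k (\<lambda>j. b $ j))"
      then have l: "l < n" by simp
      have "w $ l = (\<Sum>j<n. (vs ! j) $ l * b $ j)"
        using l len b by (simp add: wP P_def scalar_prod_def mat_of_cols_def lessThan_atLeast0)
      also have "\<dots> = (\<Sum>j<?k. (vs ! j) $ l * b $ j)"
        by (rule sum.mono_neutral_right) (use len b in \<open>auto simp: vs_def\<close>)
      also have "\<dots> = (\<Sum>j<?k. (as ! j) $ l * b $ j)"
        by (rule sum.cong) (use len in \<open>auto simp: vs_def nth_append\<close>)
      finally show "w $ l = (mat_of_cols n as *\<^sub>v vec ?k (\<lambda>j. b $ j)) $ l"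
        using l by (simp add: scalar_prod_def mat_of_cols_def lessThan_atLeast0)
    qed (use P b w in auto)
    then have "w \<in> span_list as"
      using lc[of as] as Ac by (auto simp: span_list_def)
    then show "w \<in> W" using span_list_as_span[of as] as spanA Ac by simp
  qed
qed

text \<open>Invertibility is automatic: the inverse of \<open>M g\<close> is the value of
  \<open>M\<close> at the inverse of \<open>g\<close>.\<close>

lemma representationI:
  assumes "group G"
    and carrier: "\<And>g. g \<in> carrier G \<Longrightarrow> M g \<in> carrier_mat n n"
    and mult: "\<And>g h. g \<in> carrier G \<Longrightarrow> h \<in> carrier G \<Longrightarrow> M (g \<otimes>\<^bsub>G\<^esub> h) = M g * M h"
    and one: "M \<one>\<^bsub>G\<^esub> = 1\<^sub>m n"
  shows "representation G n M"
proof -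
  interpret group G by fact
  have "M g * M (inv\<^bsub>G\<^esub> g) = 1\<^sub>m n" "M (inv\<^bsub>G\<^esub> g) * M g = 1\<^sub>m n" if "g \<in> carrier G" for g
    using mult[of g "inv\<^bsub>G\<^esub> g"] mult[of "inv\<^bsub>G\<^esub> g" g] that one by auto
  then have "M g \<in> Units (ring_mat TYPE(complex) n ())" if "g \<in> carrier G" for g
    using that carrier[of g] carrier[of "inv\<^bsub>G\<^esub> g"] by (auto simp: Units_def ring_mat_simps)
  then show ?thesis
    using mult by (auto simp: representation_def hom_def units_of_def ring_mat_simps)
qed

lemma representationD:
  assumes "group G" "representation G n \<rho>"
  shows "\<And>g. g \<in> carrier G \<Longrightarrow> \<rho> g \<in> carrier_mat n n"
    and "\<And>g h. g \<in> carrier G \<Longrightarrow> h \<in> carrier G \<Longrightarrow> \<rho> (g \<otimes>\<^bsub>G\<^esub> h) = \<rho> g * \<rho> h"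
    and "\<rho> \<one>\<^bsub>G\<^esub> = 1\<^sub>m n"
proof -
  interpret R: ring "ring_mat TYPE(complex) n ()" by (rule ring_mat)
  have h: "\<rho> \<in> hom G (units_of (ring_mat TYPE(complex) n ()))"
    using assms by (simp add: representation_def)
  show "\<And>g. g \<in> carrier G \<Longrightarrow> \<rho> g \<in> carrier_mat n n"
    using h by (auto simp: hom_def units_of_def Units_def ring_mat_simps)
  show "\<And>g h. g \<in> carrier G \<Longrightarrow> h \<in> carrier G \<Longrightarrow> \<rho> (g \<otimes>\<^bsub>G\<^esub> h) = \<rho> g * \<rho> h"
    using h by (auto simp: hom_def units_of_def ring_mat_simps)
  show "\<rho> \<one>\<^bsub>G\<^esub> = 1\<^sub>m n"
    using hom_one[OF h assms(1) R.units_group] by (simp add: units_of_def ring_mat_simps)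
qed

section \<open>Closure properties of effective characters\<close>

lemma effective_cong:
  assumes "effective G \<chi>" "\<And>g. g \<in> carrier G \<Longrightarrow> \<psi> g = \<chi> g"
  shows "effective G \<psi>"
  using assms unfolding effective_def by simp

lemma effective_zero: "effective G (\<lambda>g. 0)"
  unfolding effective_def by (rule exI[of _ "{}"]) auto

lemma effective_irreducible:
  assumes "irreducible_character G \<chi>"
  shows "effective G \<chi>"
  unfolding effective_def
  by (rule exI[of _ "{\<chi>}"], rule exI[of _ "\<lambda>_. 1"]) (use assms in auto)

lemma effective_add:
  assumes "effective G \<chi>" "effective G \<psi>"
  shows "effective G (\<lambda>g. \<chi> g + \<psi> g)"
proof -
  obtain A and c :: "('a \<Rightarrow> complex) \<Rightarrow> nat" where A: "finite A" "\<forall>\<psi>\<in>A. irreducible_character G \<psi>"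
    "\<forall>g\<in>carrier G. \<chi> g = (\<Sum>\<psi>\<in>A. of_nat (c \<psi>) * \<psi> g)"
    using assms(1) by (auto simp: effective_def)
  obtain B and d :: "('a \<Rightarrow> complex) \<Rightarrow> nat" where B: "finite B" "\<forall>\<psi>\<in>B. irreducible_character G \<psi>"
    "\<forall>g\<in>carrier G. \<psi> g = (\<Sum>\<psi>\<in>B. of_nat (d \<psi>) * \<psi> g)"
    using assms(2) by (auto simp: effective_def)
  \<comment> \<open>\<open>A\<close> and \<open>B\<close> may share irreducible characters, so
    multiplicities are added on the union.\<close>
  define e where "e \<phi> = (if \<phi> \<in> A then c \<phi> else 0) + (if \<phi> \<in> B then d \<phi> else 0)" for \<phi>
  have "\<chi> g + \<psi> g = (\<Sum>\<phi>\<in>A \<union> B. of_nat (e \<phi>) * \<phi> g)" if g: "g \<in> carrier G" for g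
  proof -
    have "(\<Sum>\<phi>\<in>A \<union> B. of_nat (e \<phi>) * \<phi> g)
        = (\<Sum>\<phi>\<in>A \<union> B. (if \<phi> \<in> A then of_nat (c \<phi>) * \<phi> g else 0))
          + (\<Sum>\<phi>\<in>A \<union> B. (if \<phi> \<in> B then of_nat (d \<phi>) * \<phi> g else 0))"
      unfolding sum.distrib[symmetric]
      by (rule sum.cong) (auto simp: e_def algebra_simps)
    also have "\<dots> = (\<Sum>\<phi>\<in>A. of_nat (c \<phi>) * \<phi> g) + (\<Sum>\<phi>\<in>B. of_nat (d \<phi>) * \<phi> g)"
      using A(1) B(1) by (simp add: sum.If_cases Int_absorb1)
    finally show ?thesis using A(3) B(3) g by simp
  qed
  then show ?thesis
    unfolding effective_def
    by (intro exI[of _ "A \<union> B"] exI[of _ e]) (use A B in auto)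
qed

text \<open>Replaces the indices \<open>0..<n\<close> of a matrix representation by an arbitrary
  finite set, so that a diagonal block may keep its original indices and a basis may be indexed by
  faces. An enumeration of \<open>B\<close> transports the entries and preserves the trace.\<close>

lemma representation_of_kernel:
  fixes K :: "'g \<Rightarrow> 'x \<Rightarrow> 'x \<Rightarrow> complex"
  assumes G: "group G" and B: "finite B"
    and mult: "\<And>g h x z. g \<in> carrier G \<Longrightarrow> h \<in> carrier G \<Longrightarrow> x \<in> B \<Longrightarrow> z \<in> B \<Longrightarrow>
      K (g \<otimes>\<^bsub>G\<^esub> h) x z = (\<Sum>y\<in>B. K g x y * K h y z)"
    and one: "\<And>x z. x \<in> B \<Longrightarrow> z \<in> B \<Longrightarrow> K \<one>\<^bsub>G\<^esub> x z = of_bool (x = z)"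
  obtains \<rho> where "representation G (card B) \<rho>"
    and "\<And>g. mat_trace (\<rho> g) = (\<Sum>x\<in>B. K g x x)"
proof -
  obtain b where b: "bij_betw b {0..<card B} B"
    using ex_bij_betw_nat_finite[OF B] by blast
  have bB: "b i \<in> B" if "i < card B" for i using b that by (auto simp: bij_betw_def)
  have beq: "b i = b j \<longleftrightarrow> i = j" if "i < card B" "j < card B" for i j
    using b that by (auto simp: bij_betw_def inj_on_def)
  have reindex: "(\<Sum>x\<in>B. f x) = (\<Sum>i\<in>{0..<card B}. f (b i))" for f :: "'x \<Rightarrow> complex"
    by (rule sum.reindex_bij_betw[OF b, symmetric])
  define \<rho> where "\<rho> g = mat (card B) (card B) (\<lambda>(i, j). K g (b i) (b j))" for g
  have "representation G (card B) \<rho>"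
  proof (rule representationI[OF G])
    fix g h assume "g \<in> carrier G" "h \<in> carrier G"
    then show "\<rho> (g \<otimes>\<^bsub>G\<^esub> h) = \<rho> g * \<rho> h"
      by (intro eq_matI) (auto simp: \<rho>_def scalar_prod_def mult bB reindex)
  next
    show "\<rho> \<one>\<^bsub>G\<^esub> = 1\<^sub>m (card B)"
      by (rule eq_matI) (auto simp: \<rho>_def one bB beq)
  qed (auto simp: \<rho>_def)
  moreover have "mat_trace (\<rho> g) = (\<Sum>x\<in>B. K g x x)" for g
    by (simp add: mat_trace_def \<rho>_def reindex lessThan_atLeast0)
  ultimately show ?thesis using that by blast
qed

lemma mat_trace_mult_commute:
  fixes A B :: "'a::comm_semiring_0 mat"
  assumes "A \<in> carrier_mat n m" "B \<in> carrier_mat m n"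
  shows "mat_trace (A * B) = mat_trace (B * A)"
proof -
  have "mat_trace (A * B) = (\<Sum>i<n. \<Sum>j<m. A $$ (i, j) * B $$ (j, i))"
    using assms by (auto simp: mat_trace_def scalar_prod_def lessThan_atLeast0 intro!: sum.cong)
  also have "\<dots> = (\<Sum>j<m. \<Sum>i<n. B $$ (j, i) * A $$ (i, j))"
    by (subst sum.swap) (simp add: mult.commute)
  also have "\<dots> = mat_trace (B * A)"
    using assms by (auto simp: mat_trace_def scalar_prod_def lessThan_atLeast0 intro!: sum.cong)
  finally show ?thesis .
qed

text \<open>Strong induction on the degree. For a reducible representation the two diagonal blocks
  of the triangular form are themselves multiplicative, have smaller degree, and their traces add up
  to the trace of \<open>\<rho>\<close>.\<close>

lemma effective_representation:
  assumes G: "group G" and "representation G n \<rho>"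
  shows "effective G (\<lambda>g. mat_trace (\<rho> g))"
  using assms(2)
proof (induction n arbitrary: \<rho> rule: less_induct)
  case (less n)
  note rep = representationD[OF G less.prems]
  \<comment> \<open>The induction hypothesis, restated for matrices indexed by any set of fewer than
    \<open>n\<close> naturals; it will be applied to \<open>{..<k}\<close> and
    \<open>{k..<n}\<close>.\<close>
  have effK: "effective G (\<lambda>g. \<Sum>x\<in>B. K g x x)"
    if fin: "finite B" and smaller: "card B < n" and mult:
      "\<And>g h x z. g \<in> carrier G \<Longrightarrow> h \<in> carrier G \<Longrightarrow> x \<in> B \<Longrightarrow> z \<in> B \<Longrightarrow>
        K (g \<otimes>\<^bsub>G\<^esub> h) x z = (\<Sum>y\<in>B. K g x y * K h y z)"
      and one: "\<And>x z. x \<in> B \<Longrightarrow> z \<in> B \<Longrightarrow> K \<one>\<^bsub>G\<^esub> x z = of_bool (x = z)"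
    for B :: "nat set" and K :: "'a \<Rightarrow> nat \<Rightarrow> nat \<Rightarrow> complex"
  proof -
    obtain \<sigma> where \<sigma>: "representation G (card B) \<sigma>" "\<And>g. mat_trace (\<sigma> g) = (\<Sum>x\<in>B. K g x x)"
      using representation_of_kernel[where K = K, OF G fin mult one] by blast
    show ?thesis using less.IH[OF smaller \<sigma>(1)] by (simp add: \<sigma>(2))
  qed
  \<comment> \<open>Degree 0 is a separate case because an irreducible representation has positive
    degree; its trace is an empty sum.\<close>
  consider "n = 0" | "irreducible_representation G n \<rho>" | "0 < n" "\<not> irreducible_representation G n \<rho>"
    by blast
  then show ?case
  proof cases
    case 1
    have "dim_row (\<rho> g) = 0" if "g \<in> carrier G" for g
      using rep(1)[OF that] 1 by simp
    then show ?thesis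
      by (intro effective_cong[OF effective_zero]) (simp add: mat_trace_def)
  next
    case 2
    then show ?thesis
      by (intro effective_irreducible) (auto simp: irreducible_character_def)
  next
    case 3
    then obtain W where W: "VectorSpace.subspace class_ring W (module_vec TYPE(complex) n)"
      and inv: "\<And>g w. g \<in> carrier G \<Longrightarrow> w \<in> W \<Longrightarrow> \<rho> g *\<^sub>v w \<in> W"
      and W0: "W \<noteq> {0\<^sub>v n}" and Wn: "W \<noteq> carrier_vec n"
      using less.prems by (auto simp: irreducible_representation_def)
    interpret vec_space "TYPE(complex)" n .
    obtain k P Q where P: "P \<in> carrier_mat n n" and Q: "Q \<in> carrier_mat n n"
      and PQ: "P * Q = 1\<^sub>m n" and QP: "Q * P = 1\<^sub>m n"
      and Weq: "W = {w \<in> carrier_vec n. \<forall>i. k \<le> i \<and> i < n \<longrightarrow> (Q *\<^sub>v w) $ i = 0}"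
      by (rule subspace_coordinates[OF W])
    \<comment> \<open>For \<open>k = 0\<close> all coordinates of a vector of \<open>W\<close>
      vanish and \<open>W\<close> is zero; for \<open>n \<le> k\<close> there is no condition and
      \<open>W\<close> is the whole space. Hence both blocks are proper.\<close>
    have "k \<noteq> 0"
    proof
      assume k: "k = 0"
      have "w = 0\<^sub>v n" if w: "w \<in> W" for w
      proof -
        have wc: "w \<in> carrier_vec n" and "\<forall>i<n. (Q *\<^sub>v w) $ i = 0"
          using w k by (auto simp: Weq)
        then have "Q *\<^sub>v w = 0\<^sub>v n" using Q by (intro eq_vecI) auto
        then have "P *\<^sub>v (Q *\<^sub>v w) = 0\<^sub>v n" using P by auto
        then show ?thesis
          using P Q wc by (simp add: assoc_mult_mat_vec[of _ n n _ n, symmetric] PQ)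
      qed
      moreover have "0\<^sub>v n \<in> W"
        using Q by (auto simp: Weq)
      ultimately show False using W0 by blast
    qed
    moreover have "k < n" using Wn by (auto simp: Weq not_less)
    ultimately have k: "0 < k" "k < n" by auto
    define \<sigma> where "\<sigma> g = Q * \<rho> g * P" for g
    have \<sigma>c: "\<sigma> g \<in> carrier_mat n n" if "g \<in> carrier G" for g
      using rep(1)[OF that] P Q by (simp add: \<sigma>_def)
    have \<sigma>mult: "\<sigma> (g \<otimes>\<^bsub>G\<^esub> h) = \<sigma> g * \<sigma> h" if "g \<in> carrier G" "h \<in> carrier G" for g h
    proof -
      note c = rep(1)[OF that(1)] rep(1)[OF that(2)]
      have "\<sigma> g * \<sigma> h = Q * \<rho> g * (P * Q) * \<rho> h * P"
        using c P Q by (simp add: \<sigma>_def assoc_mult_mat[of _ n n _ n _ n])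
      also have "\<dots> = \<sigma> (g \<otimes>\<^bsub>G\<^esub> h)"
        using c P Q that by (simp add: PQ \<sigma>_def rep(2) assoc_mult_mat[of _ n n _ n _ n])
      finally show ?thesis by simp
    qed
    have \<sigma>one: "\<sigma> \<one>\<^bsub>G\<^esub> = 1\<^sub>m n" using P Q by (simp add: \<sigma>_def rep(3) QP)
    \<comment> \<open>The first \<open>k\<close> columns of \<open>P\<close> lie in
      \<open>W\<close>. Invariance of \<open>W\<close> keeps their images in \<open>W\<close>, so
      the lower left block of \<open>\<sigma> g\<close> vanishes.\<close>
    have zero: "\<sigma> g $$ (i, j) = 0" if g: "g \<in> carrier G" and ij: "j < k" "k \<le> i" "i < n" for g i j
    proof -
      have j: "j < n" using ij k by simp
      have "Q *\<^sub>v col P j = unit_vec n j"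
        using col_mult2[OF Q P j] QP j by simp
      then have "col P j \<in> W"
        using P j ij by (auto simp: Weq)
      then have "\<rho> g *\<^sub>v col P j \<in> W" by (rule inv[OF g])
      then have "(Q *\<^sub>v (\<rho> g *\<^sub>v col P j)) $ i = 0" using ij by (auto simp: Weq)
      moreover have "col (\<sigma> g) j = Q *\<^sub>v (\<rho> g *\<^sub>v col P j)"
        using col_mult2[OF Q mult_carrier_mat[OF rep(1)[OF g] P] j] col_mult2[OF rep(1)[OF g] P j]
          assoc_mult_mat[OF Q rep(1)[OF g] P]
        by (simp only: \<sigma>_def)
      ultimately show ?thesis
        using \<sigma>c[OF g] ij j by (metis carrier_matD index_col)
    qed
    \<comment> \<open>The product is split at \<open>k\<close>: when \<open>x\<close> and
      \<open>z\<close> belong to the same block, the summands with \<open>y\<close> in the other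
      block contain a factor from the zero block.\<close>
    have entry: "\<sigma> (g \<otimes>\<^bsub>G\<^esub> h) $$ (x, z)
        = (\<Sum>y\<in>{..<k}. \<sigma> g $$ (x, y) * \<sigma> h $$ (y, z)) + (\<Sum>y\<in>{k..<n}. \<sigma> g $$ (x, y) * \<sigma> h $$ (y, z))"
      if "g \<in> carrier G" "h \<in> carrier G" "x < n" "z < n" for g h x z
    proof -
      have "\<sigma> (g \<otimes>\<^bsub>G\<^esub> h) $$ (x, z) = (\<Sum>y\<in>{0..<n}. \<sigma> g $$ (x, y) * \<sigma> h $$ (y, z))"
        using \<sigma>c[OF that(1)] \<sigma>c[OF that(2)] that by (simp add: \<sigma>mult scalar_prod_def)
      also have "\<dots> = (\<Sum>y\<in>{0..<k}. \<sigma> g $$ (x, y) * \<sigma> h $$ (y, z))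
          + (\<Sum>y\<in>{k..<n}. \<sigma> g $$ (x, y) * \<sigma> h $$ (y, z))"
        using k by (intro sum.atLeastLessThan_concat[symmetric]) auto
      finally show ?thesis by (simp add: lessThan_atLeast0)
    qed
    have "effective G (\<lambda>g. \<Sum>x\<in>{..<k}. \<sigma> g $$ (x, x))"
    proof (rule effK[of _ "\<lambda>g i j. \<sigma> g $$ (i, j)"])
      fix g h x z assume gh: "g \<in> carrier G" "h \<in> carrier G" and xz: "x \<in> {..<k}" "z \<in> {..<k}"
      have "(\<Sum>y\<in>{k..<n}. \<sigma> g $$ (x, y) * \<sigma> h $$ (y, z)) = 0"
        by (rule sum.neutral) (use zero gh xz in auto)
      then show "\<sigma> (g \<otimes>\<^bsub>G\<^esub> h) $$ (x, z) = (\<Sum>y\<in>{..<k}. \<sigma> g $$ (x, y) * \<sigma> h $$ (y, z))"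
        using entry[OF gh, of x z] xz k by simp
    qed (use k \<sigma>one in auto)
    moreover have "effective G (\<lambda>g. \<Sum>x\<in>{k..<n}. \<sigma> g $$ (x, x))"
    proof (rule effK[of _ "\<lambda>g i j. \<sigma> g $$ (i, j)"])
      fix g h x z assume gh: "g \<in> carrier G" "h \<in> carrier G" and xz: "x \<in> {k..<n}" "z \<in> {k..<n}"
      have "(\<Sum>y\<in>{..<k}. \<sigma> g $$ (x, y) * \<sigma> h $$ (y, z)) = 0"
        by (rule sum.neutral) (use zero gh xz in auto)
      then show "\<sigma> (g \<otimes>\<^bsub>G\<^esub> h) $$ (x, z) = (\<Sum>y\<in>{k..<n}. \<sigma> g $$ (x, y) * \<sigma> h $$ (y, z))"
        using entry[OF gh, of x z] xz k by simp
    qed (use k \<sigma>one in auto)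
    ultimately have "effective G (\<lambda>g. (\<Sum>x\<in>{..<k}. \<sigma> g $$ (x, x)) + (\<Sum>x\<in>{k..<n}. \<sigma> g $$ (x, x)))"
      by (rule effective_add)
    then show ?thesis
    proof (rule effective_cong)
      fix g assume g: "g \<in> carrier G"
      have "mat_trace (\<rho> g) = mat_trace (\<rho> g * (P * Q))"
        using rep(1)[OF g] by (simp add: PQ)
      also have "\<dots> = mat_trace (\<sigma> g)"
        using mat_trace_mult_commute[of "\<rho> g * P" n n Q] rep(1)[OF g] P Q
        by (simp add: \<sigma>_def assoc_mult_mat[of _ n n _ n _ n])
      also have "\<dots> = (\<Sum>x\<in>{0..<n}. \<sigma> g $$ (x, x))"
        using \<sigma>c[OF g] by (simp add: mat_trace_def lessThan_atLeast0)
      also have "\<dots> = (\<Sum>x\<in>{0..<k}. \<sigma> g $$ (x, x)) + (\<Sum>x\<in>{k..<n}. \<sigma> g $$ (x, x))"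
        using k by (intro sum.atLeastLessThan_concat[symmetric]) auto
      finally show "mat_trace (\<rho> g) = (\<Sum>x\<in>{..<k}. \<sigma> g $$ (x, x)) + (\<Sum>x\<in>{k..<n}. \<sigma> g $$ (x, x))"
        by (simp add: lessThan_atLeast0)
    qed
  qed
qed

corollary effective_of_kernel:
  fixes K :: "'g \<Rightarrow> 'x \<Rightarrow> 'x \<Rightarrow> complex"
  assumes G: "group G" and B: "finite B"
    and "\<And>g h x z. g \<in> carrier G \<Longrightarrow> h \<in> carrier G \<Longrightarrow> x \<in> B \<Longrightarrow> z \<in> B \<Longrightarrow>
      K (g \<otimes>\<^bsub>G\<^esub> h) x z = (\<Sum>y\<in>B. K g x y * K h y z)"
    and "\<And>x z. x \<in> B \<Longrightarrow> z \<in> B \<Longrightarrow> K \<one>\<^bsub>G\<^esub> x z = of_bool (x = z)"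
  shows "effective G (\<lambda>g. \<Sum>x\<in>B. K g x x)"
proof -
  obtain \<rho> where \<rho>: "representation G (card B) \<rho>" "\<And>g. mat_trace (\<rho> g) = (\<Sum>x\<in>B. K g x x)"
    using representation_of_kernel[where K = K, OF assms] by blast
  show ?thesis using effective_representation[OF G \<rho>(1)] by (simp add: \<rho>(2))
qed

section \<open>Permutation characters\<close>

text \<open>Compares two permutation characters through an equivariant surjection \<open>p\<close>
  defined only on an invariant part \<open>D\<close> of \<open>X\<close>. With \<open>D\<close> and
  \<open>Y\<close> empty it says that a single permutation character is effective.\<close>

lemma effective_fixed_points_diff:
  fixes act :: "'g \<Rightarrow> 'x \<Rightarrow> 'x" and act' :: "'g \<Rightarrow> 'y \<Rightarrow> 'y"
  assumes G: "group G" and X: "finite X"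
    and act: "\<And>g x. g \<in> carrier G \<Longrightarrow> x \<in> X \<Longrightarrow> act g x \<in> X"
    and act_one: "\<And>x. x \<in> X \<Longrightarrow> act \<one>\<^bsub>G\<^esub> x = x"
    and act_mult: "\<And>g h x. g \<in> carrier G \<Longrightarrow> h \<in> carrier G \<Longrightarrow> x \<in> X \<Longrightarrow>
      act (g \<otimes>\<^bsub>G\<^esub> h) x = act g (act h x)"
    and D: "D \<subseteq> X" "\<And>g x. g \<in> carrier G \<Longrightarrow> x \<in> D \<Longrightarrow> act g x \<in> D"
    and p: "p ` D = Y" "\<And>g x. g \<in> carrier G \<Longrightarrow> x \<in> D \<Longrightarrow> p (act g x) = act' g (p x)"
  shows "effective G (\<lambda>g. of_nat (card {x \<in> X. act g x = x}) - of_nat (card {y \<in> Y. act' g y = y}))"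
proof -
  interpret group G by fact
  \<comment> \<open>\<open>s x\<close> is a chosen representative of the fibre of \<open>p\<close>
    through \<open>x\<close>. It depends only on \<open>p x\<close>, and it need not commute with
    the action.\<close>
  define s where "s x = inv_into D p (p x)" for x
  have s: "s x \<in> D" "p (s x) = p x" if "x \<in> D" for x
    using that by (auto simp: s_def inv_into_into f_inv_into_f)
  have s_cong: "s x = s y" if "p x = p y" for x y
    using that by (simp add: s_def)
  have ss: "s (s x) = s x" if "x \<in> D" for x
    using s[OF that] by (intro s_cong)
  have s_act: "s (act g (s x)) = s (act g x)" if "g \<in> carrier G" "x \<in> D" for g x
    using s[OF that(2)] that p(2) by (intro s_cong) simp
  have D_iff: "act g x \<in> D \<longleftrightarrow> x \<in> D" if g: "g \<in> carrier G" and x: "x \<in> X" for g x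
  proof
    assume "act g x \<in> D"
    then have "act (inv\<^bsub>G\<^esub> g) (act g x) \<in> D" using g D(2) by simp
    also have "act (inv\<^bsub>G\<^esub> g) (act g x) = x"
      using g x act_mult[of "inv\<^bsub>G\<^esub> g" g x] act_one by simp
    finally show "x \<in> D" .
  qed (use g D in auto)
  \<comment> \<open>The surjection \<open>p\<close>, extended by 0 to \<open>X - D\<close>, induces an equivariant map of permutation
    modules. The vectors \<open>x - s x\<close> with \<open>x \<in> D\<close> outside \<open>s ` D\<close>, together with the elements of
    \<open>X - D\<close>, form a basis of its kernel; \<open>K\<close> is the matrix of the action in this basis.\<close>
  define K :: "'g \<Rightarrow> 'x \<Rightarrow> 'x \<Rightarrow> complex" where
    "K g u x = of_bool (act g x = u) - of_bool (x \<in> D \<and> act g (s x) = u)" for g u x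
  \<comment> \<open>A representative satisfies \<open>s y = y\<close>, so the two terms of
    \<open>K g u y\<close> cancel. Sums over the basis can therefore be extended to all of
    \<open>X\<close>.\<close>
  have K0: "K g u y = 0" if "y \<in> s ` D" for g u y
    using that ss s by (auto simp: K_def)
  have "effective G (\<lambda>g. \<Sum>x\<in>X - s ` D. K g x x)"
  proof (rule effective_of_kernel[where K = K, OF G])
    fix g h u x
    assume g: "g \<in> carrier G" and h: "h \<in> carrier G" and u: "u \<in> X - s ` D" and x: "x \<in> X - s ` D"
    have sx: "s x \<in> X" if "x \<in> D" using s(1)[OF that] D(1) by blast
    have "(\<Sum>y\<in>X - s ` D. K g u y * K h y x) = (\<Sum>y\<in>X. K g u y * K h y x)"
      by (rule sum.mono_neutral_left) (use X K0 in auto)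
    also have "\<dots> = (\<Sum>y\<in>X. if act h x = y then K g u y else 0)
        - (\<Sum>y\<in>X. if act h (s x) = y then of_bool (x \<in> D) * K g u y else 0)"
      unfolding sum_subtractf[symmetric]
      by (rule sum.cong) (auto simp: K_def[of h])
    also have "\<dots> = K g u (act h x) - of_bool (x \<in> D) * K g u (act h (s x))"
      using X x act[OF h] sx by (auto simp: sum.delta')
    \<comment> \<open>For \<open>x\<close> in \<open>D\<close>, the elements \<open>act h x\<close>
      and \<open>act h (s x)\<close> lie in the same fibre, so the terms containing their common
      representative cancel. For \<open>x\<close> outside \<open>D\<close>, \<open>act h x\<close>
      is outside \<open>D\<close> too.\<close>
    also have "\<dots> = K (g \<otimes>\<^bsub>G\<^esub> h) u x"
    proof (cases "x \<in> D")
      case True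
      then show ?thesis
        using x g h D(2)[OF h True] D(2)[OF h s(1)[OF True]] s_act[OF h True] sx[OF True]
        by (simp add: K_def act_mult)
    next
      case False
      then show ?thesis
        using x g h D_iff[OF h, of x] by (simp add: K_def act_mult)
    qed
    finally show "K (g \<otimes>\<^bsub>G\<^esub> h) u x = (\<Sum>y\<in>X - s ` D. K g u y * K h y x)" by simp
  next
    fix u x assume "u \<in> X - s ` D" "x \<in> X - s ` D"
    then show "K \<one>\<^bsub>G\<^esub> u x = of_bool (u = x)"
      using s(1) D(1) by (auto simp: K_def act_one subset_iff) (metis imageI)
  qed (use X in simp)
  then show ?thesis
  proof (rule effective_cong)
    fix g assume g: "g \<in> carrier G"
    \<comment> \<open>The trace is the number of fixed points in \<open>X\<close> minus the number
      of \<open>x\<close> in \<open>D\<close> with \<open>act g (s x) = x\<close>. Each fibre over a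
      fixed point of \<open>Y\<close> contains exactly one such \<open>x\<close>, namely the
      translate by \<open>g\<close> of its representative.\<close>
    have "bij_betw p {x \<in> D. act g (s x) = x} {y \<in> Y. act' g y = y}"
    proof (rule bij_betwI')
      fix x y assume "x \<in> {x \<in> D. act g (s x) = x}" "y \<in> {x \<in> D. act g (s x) = x}"
      then have "act g (s x) = x" "act g (s y) = y" by blast+
      then show "p x = p y \<longleftrightarrow> x = y" using s_cong by metis
    next
      fix x assume "x \<in> {x \<in> D. act g (s x) = x}"
      then show "p x \<in> {y \<in> Y. act' g y = y}"
        using s p g by (metis (mono_tags, lifting) imageI mem_Collect_eq)
    next
      fix y assume y: "y \<in> {y \<in> Y. act' g y = y}"
      then obtain x where x: "x \<in> D" "y = p x" using p(1) by auto
      have "p (act g (s x)) = p x" using s[OF x(1)] p(2) g x y by auto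
      then have "s (act g (s x)) = s x" by (rule s_cong)
      then show "\<exists>x\<in>{x \<in> D. act g (s x) = x}. y = p x"
        using s[OF x(1)] D(2) g \<open>p (act g (s x)) = p x\<close> x by (intro bexI[of _ "act g (s x)"]) auto
    qed
    then have card: "card {x \<in> D. act g (s x) = x} = card {y \<in> Y. act' g y = y}"
      by (rule bij_betw_same_card)
    have "(\<Sum>x\<in>X - s ` D. K g x x) = (\<Sum>x\<in>X. K g x x)"
      by (rule sum.mono_neutral_left) (use X K0 in auto)
    also have "\<dots> = (\<Sum>x\<in>X. of_bool (act g x = x)) - (\<Sum>x\<in>X. of_bool (x \<in> D \<and> act g (s x) = x))"
      unfolding sum_subtractf[symmetric] K_def ..
    also have "(\<Sum>x\<in>X. of_bool (act g x = x)) = (of_nat (card {x \<in> X. act g x = x}) :: complex)"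
      using X by (simp add: of_bool_def sum.If_cases Int_def)
    also have "(\<Sum>x\<in>X. of_bool (x \<in> D \<and> act g (s x) = x))
        = (of_nat (card {x \<in> X. x \<in> D \<and> act g (s x) = x}) :: complex)"
      using X by (simp add: of_bool_def sum.If_cases Int_def)
    also have "{x \<in> X. x \<in> D \<and> act g (s x) = x} = {x \<in> D. act g (s x) = x}"
      using D(1) by blast
    finally show "of_nat (card {x \<in> X. act g x = x}) - of_nat (card {y \<in> Y. act' g y = y})
        = (\<Sum>x\<in>X - s ` D. K g x x)"
      by (simp add: card)
  qed
qed

text \<open>\<open>act h\<close> carries the fixed points of \<open>g\<close> bijectively onto the
  fixed points of the conjugate of \<open>g\<close> by \<open>h\<close>.\<close>

lemma class_function_fixed_points:
  fixes act :: "'g \<Rightarrow> 'x \<Rightarrow> 'x"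
  assumes G: "group G"
    and act: "\<And>g x. g \<in> carrier G \<Longrightarrow> x \<in> X \<Longrightarrow> act g x \<in> X"
    and act_one: "\<And>x. x \<in> X \<Longrightarrow> act \<one>\<^bsub>G\<^esub> x = x"
    and act_mult: "\<And>g h x. g \<in> carrier G \<Longrightarrow> h \<in> carrier G \<Longrightarrow> x \<in> X \<Longrightarrow>
      act (g \<otimes>\<^bsub>G\<^esub> h) x = act g (act h x)"
  shows "class_function G (\<lambda>g. of_nat (card {x \<in> X. act g x = x}))"
proof -
  interpret group G by fact
  have inv1: "act h (act (inv\<^bsub>G\<^esub> h) x) = x" "act (inv\<^bsub>G\<^esub> h) (act h x) = x"
    if "h \<in> carrier G" "x \<in> X" for h x
    using act_mult[of h "inv\<^bsub>G\<^esub> h" x] act_mult[of "inv\<^bsub>G\<^esub> h" h x] that act_one by auto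
  have bij: "bij_betw (act h) {x \<in> X. act g x = x} {x \<in> X. act (h \<otimes>\<^bsub>G\<^esub> g \<otimes>\<^bsub>G\<^esub> inv\<^bsub>G\<^esub> h) x = x}"
    if g: "g \<in> carrier G" and h: "h \<in> carrier G" for g h
  proof (rule bij_betw_byWitness[where f' = "act (inv\<^bsub>G\<^esub> h)"])
    have conj: "act (h \<otimes>\<^bsub>G\<^esub> g \<otimes>\<^bsub>G\<^esub> inv\<^bsub>G\<^esub> h) x = act h (act g (act (inv\<^bsub>G\<^esub> h) x))" if "x \<in> X" for x
      using g h that by (simp add: act_mult act)
    show "act h ` {x \<in> X. act g x = x} \<subseteq> {x \<in> X. act (h \<otimes>\<^bsub>G\<^esub> g \<otimes>\<^bsub>G\<^esub> inv\<^bsub>G\<^esub> h) x = x}"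
      using g h by (auto simp: conj act inv1)
    show "act (inv\<^bsub>G\<^esub> h) ` {x \<in> X. act (h \<otimes>\<^bsub>G\<^esub> g \<otimes>\<^bsub>G\<^esub> inv\<^bsub>G\<^esub> h) x = x} \<subseteq> {x \<in> X. act g x = x}"
    proof clarify
      fix x assume x: "x \<in> X" "act (h \<otimes>\<^bsub>G\<^esub> g \<otimes>\<^bsub>G\<^esub> inv\<^bsub>G\<^esub> h) x = x"
      then have "act (inv\<^bsub>G\<^esub> h) (act h (act g (act (inv\<^bsub>G\<^esub> h) x))) = act (inv\<^bsub>G\<^esub> h) x"
        by (simp add: conj)
      then show "act (inv\<^bsub>G\<^esub> h) x \<in> X \<and> act g (act (inv\<^bsub>G\<^esub> h) x) = act (inv\<^bsub>G\<^esub> h) x"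
        using x(1) g h by (simp add: inv1 act)
    qed
  qed (use h inv1 in auto)
  show ?thesis
    unfolding class_function_def by (intro ballI) (simp add: bij_betw_same_card[OF bij, symmetric])
qed

section \<open>Compositions and color sets\<close>

text \<open>Recovers \<open>S\<close> from the composition of \<open>S\<close>. The strict bounds
  discard the empty prefix and the whole list, so \<open>i\<close> may range over all
  naturals.\<close>

definition partial_sums :: "nat list \<Rightarrow> nat set" where
  "partial_sums \<alpha> = {s. 0 < s \<and> s < sum_list \<alpha> \<and> (\<exists>i. s = sum_list (take i \<alpha>))}"

lemma partial_sums_subset: "partial_sums \<alpha> \<subseteq> {1..<sum_list \<alpha>}"
  by (auto simp: partial_sums_def)

lemma sum_list_concat: "sum_list (concat xss) = sum_list (map sum_list xss)"
  by (induction xss) auto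

lemma refines_sum_list: "refines \<beta> \<alpha> \<Longrightarrow> sum_list \<beta> = sum_list \<alpha>"
  by (auto simp: refines_def sum_list_concat)

text \<open>The blocks of \<open>\<beta>\<close> that sum to a prefix of \<open>\<alpha>\<close>
  concatenate to a prefix of \<open>\<beta>\<close> with the same sum.\<close>

lemma refines_partial_sums:
  assumes "refines \<beta> \<alpha>"
  shows "partial_sums \<alpha> \<subseteq> partial_sums \<beta>"
proof -
  obtain \<beta>s where \<beta>s: "concat \<beta>s = \<beta>" "map sum_list \<beta>s = \<alpha>" using assms by (auto simp: refines_def)
  have "\<exists>j. sum_list (take i \<alpha>) = sum_list (take j \<beta>)" for i
  proof -
    have "\<beta> = concat (take i \<beta>s) @ concat (drop i \<beta>s)"
      unfolding \<beta>s(1)[symmetric] concat_append[symmetric] by simp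
    then have "take (length (concat (take i \<beta>s))) \<beta> = concat (take i \<beta>s)" by simp
    moreover have "sum_list (take i \<alpha>) = sum_list (concat (take i \<beta>s))"
      unfolding \<beta>s(2)[symmetric] take_map sum_list_concat ..
    ultimately show ?thesis by metis
  qed
  then show ?thesis
    using refines_sum_list[OF assms] by (auto simp: partial_sums_def)
qed

section \<open>The bijection between color sets and compositions\<close>

lemma length_comp_of_set: "finite S \<Longrightarrow> length (comp_of_set n S) = Suc (card S)"
  by (simp add: comp_of_set_def Let_def)

text \<open>The entries are successive differences of the list 0, \<open>S\<close>,
  \<open>n\<close>, so the sum telescopes; truncated subtraction is exact because this list is
  sorted.\<close>

lemma sum_list_take_comp_of_set:
  assumes S: "finite S" "S \<subseteq> {1..<n}" and i: "i \<le> Suc (card S)"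
  shows "sum_list (take i (comp_of_set n S)) = (0 # sorted_list_of_set S @ [n]) ! i"
proof -
  let ?ss = "sorted_list_of_set S"
  let ?zs = "0 # ?ss @ [n]"
  have len: "length ?ss = card S" using S by simp
  have "sorted ?zs" using S by (force simp: sorted_append)
  then have mono: "?zs ! j \<le> ?zs ! Suc j" if "j \<le> card S" for j
    using that len by (intro sorted_nth_mono) auto
  have nth: "comp_of_set n S ! j = ?zs ! Suc j - ?zs ! j" if "j \<le> card S" for j
    using that len by (auto simp: comp_of_set_def Let_def nth_Cons nth_append split: nat.split)
  show ?thesis using i
  proof (induction i)
    case (Suc i)
    then have "sum_list (take (Suc i) (comp_of_set n S)) = ?zs ! i + (?zs ! Suc i - ?zs ! i)"
      using length_comp_of_set[OF S(1), of n] nth[of i]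
      by (subst take_Suc_conv_app_nth) auto
    then show ?case using mono[of i] Suc.prems by simp
  qed simp
qed

lemma sum_list_comp_of_set:
  assumes "finite S" "S \<subseteq> {1..<n}"
  shows "sum_list (comp_of_set n S) = n"
  using sum_list_take_comp_of_set[OF assms, of "Suc (card S)"] length_comp_of_set[OF assms(1), of n]
    assms by (simp add: nth_append)

lemma composition_comp_of_set:
  assumes S: "finite S" "S \<subseteq> {1..<n}" and n: "0 < n"
  shows "composition (comp_of_set n S)"
proof -
  let ?zs = "0 # sorted_list_of_set S @ [n]"
  have len: "length (sorted_list_of_set S) = card S" using S by simp
  have "sorted_wrt (<) ?zs" using S n by (force simp: sorted_wrt_append)
  then have "?zs ! j < ?zs ! Suc j" if "j \<le> card S" for j
    using that len by (intro sorted_wrt_nth_less[of "(<)"]) auto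
  moreover have "comp_of_set n S ! j = ?zs ! Suc j - ?zs ! j" if "j \<le> card S" for j
    using that len by (auto simp: comp_of_set_def Let_def nth_Cons nth_append split: nat.split)
  ultimately show ?thesis
    using length_comp_of_set[OF S(1), of n] by (auto simp: composition_def in_set_conv_nth)
qed

lemma partial_sums_comp_of_set:
  assumes S: "finite S" "S \<subseteq> {1..<n}" and n: "0 < n"
  shows "partial_sums (comp_of_set n S) = S"
proof (intro equalityI subsetI)
  let ?ss = "sorted_list_of_set S"
  have len: "length ?ss = card S" using S by simp
  note lc = length_comp_of_set[OF S(1), of n]
  fix s
  { assume s: "s \<in> partial_sums (comp_of_set n S)"
    then obtain i where i: "s = sum_list (take i (comp_of_set n S))" "0 < s" "s < n"
      using sum_list_comp_of_set[OF S] by (auto simp: partial_sums_def)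
    have "i < Suc (card S)"
      by (rule ccontr) (use i sum_list_comp_of_set[OF S] lc in auto)
    moreover have "i \<noteq> 0" using i by (cases i) auto
    ultimately have "s = ?ss ! (i - 1)" "i - 1 < length ?ss"
      using i sum_list_take_comp_of_set[OF S, of i] len
      by (auto simp: nth_Cons nth_append split: nat.splits)
    then have "s \<in> set ?ss" by simp
    then show "s \<in> S" using S by simp }
  { assume s: "s \<in> S"
    then have "s \<in> set ?ss" using S by simp
    then obtain i where i: "i < length ?ss" "s = ?ss ! i" by (auto simp: in_set_conv_nth)
    then have "s = sum_list (take (Suc i) (comp_of_set n S))"
      using sum_list_take_comp_of_set[OF S, of "Suc i"] len by (simp add: nth_append)
    then show "s \<in> partial_sums (comp_of_set n S)"
      using s S by (auto simp: partial_sums_def sum_list_comp_of_set) }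
qed

text \<open>Positive entries make the prefix sums strictly increasing, so their set still determines
  the list. The sum must be positive because the empty composition is not recovered:
  \<open>comp_of_set 0 {}\<close> is \<open>[0]\<close>.\<close>

lemma comp_of_set_partial_sums:
  assumes \<alpha>: "composition \<alpha>" and pos: "0 < sum_list \<alpha>"
  shows "comp_of_set (sum_list \<alpha>) (partial_sums \<alpha>) = \<alpha>"
proof -
  let ?n = "sum_list \<alpha>"
  let ?t = "\<lambda>i. sum_list (take i \<alpha>)"
  have \<alpha>len: "0 < length \<alpha>" using pos by (cases \<alpha>) auto
  have step: "?t (Suc i) = ?t i + \<alpha> ! i" "0 < \<alpha> ! i" if "i < length \<alpha>" for i
    using that \<alpha> by (auto simp: take_Suc_conv_app_nth composition_def)
  have less: "?t i < ?t j" if "i < j" "j \<le> length \<alpha>" for i j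
    using that
  proof (induction j)
    case (Suc j)
    then show ?case using step[of j] by (cases "i = j") auto
  qed simp
  \<comment> \<open>The range from 1 to \<open>length \<alpha> - 1\<close> selects the proper
    nonempty prefixes.\<close>
  define ss where "ss = map ?t [1..<length \<alpha>]"
  have "sorted_wrt (<) ss"
    unfolding ss_def sorted_wrt_map
    by (rule sorted_wrt_mono_rel[OF _ sorted_wrt_upt]) (use less in auto)
  moreover have "set ss = partial_sums \<alpha>"
  proof (intro equalityI subsetI)
    fix s assume "s \<in> set ss"
    then obtain i where "1 \<le> i" "i < length \<alpha>" "s = ?t i" by (auto simp: ss_def)
    then show "s \<in> partial_sums \<alpha>"
      using less[of 0 i] less[of i "length \<alpha>"] by (auto simp: partial_sums_def)
  next
    fix s assume "s \<in> partial_sums \<alpha>"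
    then obtain i where i: "s = ?t i" "0 < s" "s < ?n" by (auto simp: partial_sums_def)
    have "i < length \<alpha>" by (rule ccontr) (use i in auto)
    moreover have "i \<noteq> 0" using i by (cases i) auto
    ultimately show "s \<in> set ss" using i by (auto simp: ss_def)
  qed
  ultimately have ss: "sorted_list_of_set (partial_sums \<alpha>) = ss"
    by (metis sorted_list_of_set.idem_if_sorted_distinct strict_sorted_iff)
  have "0 # ss = map ?t [0..<length \<alpha>]"
    using \<alpha>len by (simp add: ss_def upt_conv_Cons)
  moreover have "ss @ [?n] = map (\<lambda>i. ?t (Suc i)) [0..<length \<alpha>]"
  proof (rule nth_equalityI)
    show "length (ss @ [?n]) = length (map (\<lambda>i. ?t (Suc i)) [0..<length \<alpha>])"
      using \<alpha>len by (simp add: ss_def)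
    show "(ss @ [?n]) ! i = map (\<lambda>i. ?t (Suc i)) [0..<length \<alpha>] ! i" if "i < length (ss @ [?n])" for i
      using that \<alpha>len by (cases "Suc i = length \<alpha>") (auto simp: ss_def nth_append)
  qed
  ultimately show ?thesis
    unfolding comp_of_set_def ss Let_def
    by (intro nth_equalityI) (auto simp: step)
qed

section \<open>Monomial quasisymmetric functions\<close>

lemma lookup_monomial:
  assumes "sorted_wrt (<) is" "length is = length \<alpha>" "k < length \<alpha>"
  shows "Poly_Mapping.lookup (monomial is \<alpha>) (is ! k) = \<alpha> ! k"
  using assms(2,1,3)
proof (induction "is" \<alpha> arbitrary: k rule: list_induct2)
  case (Cons i "is" a \<alpha>)
  have zero: "Poly_Mapping.lookup (monomial js \<beta>) i = 0"
    if "length js = length \<beta>" "i \<notin> set js" for js \<beta>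
    using that by (induction js \<beta> rule: list_induct2)
      (auto simp: monomial_def lookup_add lookup_single)
  show ?case
  proof (cases k)
    case 0
    then show ?thesis
      using Cons zero[of "is" \<alpha>] by (auto simp: monomial_def lookup_add lookup_single)
  next
    case (Suc l)
    then have "is ! l \<noteq> i" using Cons by (metis Suc_less_eq length_Cons less_irrefl nth_mem sorted_wrt.simps(2))
    then show ?thesis
      using Cons Suc by (simp add: monomial_def lookup_add lookup_single)
  qed
qed simp

lemma keys_monomial:
  assumes "composition \<alpha>" "sorted_wrt (<) is" "length is = length \<alpha>"
  shows "Poly_Mapping.keys (monomial is \<alpha>) = set is"
  using assms(3,1,2)
proof (induction "is" \<alpha> rule: list_induct2)
  case Nil
  then show ?case by (simp add: monomial_def)
next
  case (Cons i "is" a \<alpha>)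
  have "Poly_Mapping.keys (monomial (i # is) (a # \<alpha>))
      = Poly_Mapping.keys (Poly_Mapping.single i a + monomial is \<alpha>)"
    by (simp add: monomial_def)
  also have "\<dots> = Poly_Mapping.keys (Poly_Mapping.single i a) \<union> Poly_Mapping.keys (monomial is \<alpha>)"
    by (auto simp: in_keys_iff lookup_add lookup_single when_def split: if_splits)
  finally show ?case
    using Cons by (simp add: composition_def)
qed

text \<open>As all exponents are positive, the support of the monomial is the set of indices;
  sorting it yields \<open>is\<close>, and the exponents read along \<open>is\<close> yield
  \<open>\<alpha>\<close>.\<close>

lemma monomial_inject:
  assumes \<alpha>: "composition \<alpha>" "sorted_wrt (<) is" "length is = length \<alpha>"
    and \<beta>: "composition \<beta>" "sorted_wrt (<) js" "length js = length \<beta>"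
    and eq: "monomial is \<alpha> = monomial js \<beta>"
  shows "is = js \<and> \<alpha> = \<beta>"
proof -
  have "set is = set js" using keys_monomial[OF \<alpha>] keys_monomial[OF \<beta>] eq by simp
  then have ij: "is = js" using \<alpha>(2) \<beta>(2) by (metis sorted_list_of_set.idem_if_sorted_distinct strict_sorted_iff)
  moreover have "\<alpha> = \<beta>"
    by (rule nth_equalityI) (use lookup_monomial[OF \<alpha>(2,3)] lookup_monomial[OF \<beta>(2,3)] eq ij \<alpha>(3) \<beta>(3) in auto)
  ultimately show ?thesis by simp
qed

lemma total_degree_monomial:
  assumes "composition \<alpha>" "sorted_wrt (<) is" "length is = length \<alpha>"
  shows "total_degree (monomial is \<alpha>) = sum_list \<alpha>"
proof -
  have d: "distinct is" using assms(2) by (simp add: strict_sorted_iff)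
  have "total_degree (monomial is \<alpha>) = sum_list (map (Poly_Mapping.lookup (monomial is \<alpha>)) is)"
    unfolding total_degree_def keys_monomial[OF assms] using d by (simp add: sum_list_distinct_conv_sum_set)
  also have "map (Poly_Mapping.lookup (monomial is \<alpha>)) is = \<alpha>"
    by (rule nth_equalityI) (use assms lookup_monomial in auto)
  finally show ?thesis .
qed

text \<open>At most one index sequence produces a given monomial. The value does not depend on
  \<open>js\<close>, which is the quasisymmetry of \<open>M_qsym \<alpha>\<close>.\<close>

lemma M_qsym_monomial:
  assumes \<alpha>: "composition \<alpha>" and \<beta>: "composition \<beta>" "sorted_wrt (<) js" "length js = length \<beta>"
  shows "M_qsym \<alpha> (monomial js \<beta>) = of_bool (\<alpha> = \<beta>)"
proof -
  have "{is. sorted_wrt (<) is \<and> length is = length \<alpha> \<and> monomial is \<alpha> = monomial js \<beta>}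
      = (if \<alpha> = \<beta> then {js} else {})"
    using monomial_inject[OF \<alpha> _ _ \<beta>] \<beta> by auto
  then show ?thesis by (simp add: M_qsym_def)
qed

lemma quasisymmetric_M_qsym:
  assumes \<alpha>: "composition \<alpha>"
  shows "quasisymmetric (M_qsym \<alpha>)"
  unfolding quasisymmetric_def
proof (intro conjI exI[of _ "sum_list \<alpha>"] allI impI)
  fix m assume "M_qsym \<alpha> m \<noteq> 0"
  then have "{is. sorted_wrt (<) is \<and> length is = length \<alpha> \<and> monomial is \<alpha> = m} \<noteq> {}"
    by (force simp: M_qsym_def)
  then show "total_degree m \<le> sum_list \<alpha>"
    using total_degree_monomial[OF \<alpha>] by auto
qed (auto simp: M_qsym_monomial[OF \<alpha>])

lemma quasisymmetric_sum:
  assumes "\<And>a. a \<in> A \<Longrightarrow> quasisymmetric (f a)"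
  shows "quasisymmetric (\<lambda>m. \<Sum>a\<in>A. f a m)"
proof (cases "finite A")
  case True
  obtain N where N: "total_degree m \<le> N a" if "a \<in> A" "f a m \<noteq> 0" for a m
    using assms unfolding quasisymmetric_def by metis
  have "total_degree m \<le> (\<Sum>a\<in>A. N a)" if nz: "(\<Sum>a\<in>A. f a m) \<noteq> 0" for m
  proof -
    obtain a where a: "a \<in> A" "f a m \<noteq> 0" using nz by (meson sum.neutral)
    then show ?thesis using N[OF a] member_le_sum[of a A N] True by force
  qed
  moreover have "(\<Sum>a\<in>A. f a (monomial is \<alpha>)) = (\<Sum>a\<in>A. f a (monomial js \<alpha>))"
    if "composition \<alpha> \<and> sorted_wrt (<) is \<and> sorted_wrt (<) js \<and>
      length is = length \<alpha> \<and> length js = length \<alpha>" for \<alpha> "is" js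
  proof (rule sum.cong[OF refl])
    fix a assume "a \<in> A"
    then show "f a (monomial is \<alpha>) = f a (monomial js \<alpha>)"
      using assms[of a] that unfolding quasisymmetric_def by blast
  qed
  ultimately show ?thesis unfolding quasisymmetric_def by blast
qed (auto simp: quasisymmetric_def)

section \<open>Faces of a balanced relative complex\<close>

context balanced_relative_complex
begin

lemma finite_face: "\<sigma> \<in> \<Phi> \<Longrightarrow> finite \<sigma>"
  using faces finite_V finite_subset by blast

lemma finite_complex: "finite \<Phi>"
  using faces finite_V finite_subset by blast

lemma inj_on_coloring: "\<sigma> \<in> \<Phi> \<Longrightarrow> inj_on \<kappa> \<sigma>"
  using balanced finite_face eq_card_imp_inj_on by blast

text \<open>Some facet exists, and its size \<open>d + 1\<close> is not negative. Hence
  \<open>nat\<close> truncates neither \<open>d + 1\<close> nor \<open>d + 2\<close>.\<close>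

lemma dim_ge: "- 1 \<le> d"
  using nonempty pure by fastforce

lemma colors: "{1..nat (d + 1)} = {1..<nat (d + 2)}"
  using dim_ge by (auto simp: nat_add_distrib)

lemma coloring_face: "\<sigma> \<in> \<Phi> \<Longrightarrow> \<kappa> ` \<sigma> \<subseteq> {1..<nat (d + 2)}"
  using faces coloring unfolding colors by blast

text \<open>A facet above \<open>\<rho>\<close> carries every color. Its vertices with colors in
  \<open>T\<close> lie between \<open>\<rho>\<close> and the facet, hence form a face by convexity;
  as colors are distinct on the facet, the colors of \<open>\<rho>\<close> single out
  \<open>\<rho>\<close> in it.\<close>

lemma face_extension:
  assumes \<rho>: "\<rho> \<in> \<Phi>" and sub: "\<kappa> ` \<rho> \<subseteq> T" and T: "T \<subseteq> {1..<nat (d + 2)}"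
  obtains \<sigma> where "\<sigma> \<in> \<Phi>" "\<kappa> ` \<sigma> = T" "{v \<in> \<sigma>. \<kappa> v \<in> \<kappa> ` \<rho>} = \<rho>"
proof -
  obtain \<tau> where \<tau>: "\<tau> \<in> \<Phi>" "\<rho> \<subseteq> \<tau>" "int (card \<tau>) = d + 1" using pure[OF \<rho>] by blast
  have "card (\<kappa> ` \<tau>) = card {1..<nat (d + 2)}"
    using balanced[OF \<tau>(1)] \<tau>(3) unfolding colors[symmetric] by simp
  then have all: "\<kappa> ` \<tau> = {1..<nat (d + 2)}"
    by (intro card_subset_eq coloring_face \<tau>(1)) auto
  let ?\<sigma> = "{v \<in> \<tau>. \<kappa> v \<in> T}"
  have "?\<sigma> \<in> \<Phi>" by (rule convex[OF _ _ \<rho> \<tau>(1)]) (use \<tau>(2) sub in auto)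
  moreover have "\<kappa> ` ?\<sigma> = \<kappa> ` \<tau> \<inter> T" by auto
  then have "\<kappa> ` ?\<sigma> = T" using all T by auto
  moreover have "{v \<in> ?\<sigma>. \<kappa> v \<in> \<kappa> ` \<rho>} = \<rho>"
    using \<tau>(2) sub inj_onD[OF inj_on_coloring[OF \<tau>(1)]] by blast
  ultimately show ?thesis by (rule that)
qed

end

theorem theorem8:
  fixes V :: "'v set" and \<Phi> :: "'v set set" and \<kappa> :: "'v \<Rightarrow> nat" and d :: int
    and \<GG> :: "('v \<Rightarrow> 'v) set"
  assumes "balanced_relative_complex V \<Phi> \<kappa> d"
    and "subgroup \<GG> (complex_AutoGroup V \<Phi> \<kappa>)"
  shows "qsym_class_function ((complex_AutoGroup V \<Phi> \<kappa>)\<lparr>carrier := \<GG>\<rparr>) (flag_qsym \<Phi> \<kappa> d) \<and>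
    M_increasing ((complex_AutoGroup V \<Phi> \<kappa>)\<lparr>carrier := \<GG>\<rparr>) (flag_qsym \<Phi> \<kappa> d)"
proof -
  interpret balanced_relative_complex V \<Phi> \<kappa> d by fact

  \<comment> \<open>The action of the group on the faces\<close>
  define G where "G = (complex_AutoGroup V \<Phi> \<kappa>)\<lparr>carrier := \<GG>\<rparr>"
  have G: "group G"
    unfolding G_def by (rule subgroup.subgroup_is_group[OF assms(2) group_complex_AutoGroup])
  interpret group G by (rule G)
  have aut: "g \<in> complex_auto V \<Phi> \<kappa>" if "g \<in> carrier G" for g
    using subgroup.subset[OF assms(2)] that by (auto simp: G_def complex_AutoGroup_def)
  have Bij: "g \<in> Bij V" if "g \<in> carrier G" for g
    using aut[OF that] by (simp add: complex_auto_def)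
  have act: "g ` \<sigma> \<in> \<Phi>" if "g \<in> carrier G" "\<sigma> \<in> \<Phi>" for g \<sigma>
    using aut[OF that(1)] that(2) by (simp add: complex_auto_def)
  have \<kappa>_act: "\<kappa> (g v) = \<kappa> v" if "g \<in> carrier G" "\<sigma> \<in> \<Phi>" "v \<in> \<sigma>" for g \<sigma> v
    using aut[OF that(1)] that(2,3) faces by (auto simp: complex_auto_def)
  have color_act: "\<kappa> ` g ` \<sigma> = \<kappa> ` \<sigma>" if "g \<in> carrier G" "\<sigma> \<in> \<Phi>" for g \<sigma>
    using \<kappa>_act[OF that] by (auto simp: image_image)
  have act_one: "\<one>\<^bsub>G\<^esub> ` \<sigma> = \<sigma>" if "\<sigma> \<in> \<Phi>" for \<sigma>
  proof -
    have "\<one>\<^bsub>G\<^esub> v = v" if "v \<in> \<sigma>" for v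
      using that \<open>\<sigma> \<in> \<Phi>\<close> faces by (auto simp: G_def complex_AutoGroup_def BijGroup_def)
    then show ?thesis by simp
  qed
  have act_mult: "(g \<otimes>\<^bsub>G\<^esub> h) ` \<sigma> = g ` h ` \<sigma>"
    if "g \<in> carrier G" "h \<in> carrier G" "\<sigma> \<in> \<Phi>" for g h \<sigma>
  proof -
    have "(g \<otimes>\<^bsub>G\<^esub> h) v = g (h v)" if "v \<in> \<sigma>" for v
      using subsetD[OF faces \<open>\<sigma> \<in> \<Phi>\<close>] that Bij[OF \<open>g \<in> carrier G\<close>] Bij[OF \<open>h \<in> carrier G\<close>]
      by (auto simp: subset_iff G_def complex_AutoGroup_def BijGroup_def compose_eq)
    then show ?thesis by (simp add: image_image)
  qed

  \<comment> \<open>Types of faces as compositions of \<open>d + 2\<close>\<close>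
  define n where "n = nat (d + 2)"
  have n: "0 < n" using dim_ge by (simp add: n_def)
  have face_colors: "\<kappa> ` \<sigma> \<subseteq> {1..<n}" "finite (\<kappa> ` \<sigma>)" if "\<sigma> \<in> \<Phi>" for \<sigma>
    using coloring_face[OF that] finite_face[OF that] by (auto simp: n_def)
  define c where "c \<sigma> = comp_of_set n (\<kappa> ` \<sigma>)" for \<sigma>
  have c: "composition (c \<sigma>)" "sum_list (c \<sigma>) = n" "partial_sums (c \<sigma>) = \<kappa> ` \<sigma>" if "\<sigma> \<in> \<Phi>" for \<sigma>
    using face_colors[OF that] n composition_comp_of_set sum_list_comp_of_set partial_sums_comp_of_set
    by (simp_all add: c_def)
  have c_act: "c (g ` \<sigma>) = c \<sigma>" if "g \<in> carrier G" "\<sigma> \<in> \<Phi>" for g \<sigma>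
    using color_act[OF that] by (simp add: c_def)
  define X where "X \<alpha> = {\<sigma> \<in> \<Phi>. c \<sigma> = \<alpha>}" for \<alpha>
  have X: "finite (X \<alpha>)" for \<alpha> using finite_complex by (simp add: X_def)
  have X_act: "g ` \<sigma> \<in> X \<alpha>" if "g \<in> carrier G" "\<sigma> \<in> X \<alpha>" for g \<sigma> \<alpha>
    using that act c_act by (simp add: X_def)
  have X_one: "\<one>\<^bsub>G\<^esub> ` \<sigma> = \<sigma>" if "\<sigma> \<in> X \<alpha>" for \<sigma> \<alpha>
    using that act_one by (simp add: X_def)
  have X_mult: "(g \<otimes>\<^bsub>G\<^esub> h) ` \<sigma> = g ` h ` \<sigma>"
    if "g \<in> carrier G" "h \<in> carrier G" "\<sigma> \<in> X \<alpha>" for g h \<sigma> \<alpha>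
    using that act_mult by (simp add: X_def)

  \<comment> \<open>The expansion in monomial quasisymmetric functions\<close>
  define f where "f \<alpha> g = (of_nat (card {\<sigma> \<in> X \<alpha>. g ` \<sigma> = \<sigma>}) :: complex)" for \<alpha> g
  have f_class: "class_function G (f \<alpha>)" for \<alpha>
    unfolding f_def by (rule class_function_fixed_points[where act = "(`)", OF G X_act X_one X_mult])
  have flag: "flag_qsym \<Phi> \<kappa> d g = (\<lambda>m. \<Sum>\<sigma> | \<sigma> \<in> \<Phi> \<and> g ` \<sigma> = \<sigma>. M_qsym (c \<sigma>) m)" for g
    by (simp add: flag_qsym_def c_def n_def)
  \<comment> \<open>\<open>f \<alpha> g\<close> counts fixed faces of type \<open>\<alpha>\<close>,
    so it is nonzero exactly when \<open>\<alpha>\<close> is the type of a fixed face.\<close>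
  have support: "{\<alpha>. composition \<alpha> \<and> f \<alpha> g \<noteq> 0} = c ` {\<sigma> \<in> \<Phi>. g ` \<sigma> = \<sigma>}" for g
    using finite_complex c(1) by (auto simp: f_def X_def)
  have fin_support: "finite {\<alpha>. composition \<alpha> \<and> f \<alpha> g \<noteq> 0}" for g
    unfolding support using finite_complex by simp
  have F: "flag_qsym \<Phi> \<kappa> d g = (\<lambda>m. \<Sum>\<alpha> | composition \<alpha> \<and> f \<alpha> g \<noteq> 0. f \<alpha> g * M_qsym \<alpha> m)" for g
  proof
    fix m
    let ?Fix = "{\<sigma> \<in> \<Phi>. g ` \<sigma> = \<sigma>}"
    have "flag_qsym \<Phi> \<kappa> d g m = (\<Sum>\<alpha>\<in>c ` ?Fix. \<Sum>\<sigma> | \<sigma> \<in> ?Fix \<and> c \<sigma> = \<alpha>. M_qsym (c \<sigma>) m)"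
      unfolding flag by (rule sum.image_gen) (simp add: finite_complex)
    also have "\<dots> = (\<Sum>\<alpha>\<in>c ` ?Fix. f \<alpha> g * M_qsym \<alpha> m)"
    proof (rule sum.cong[OF refl])
      fix \<alpha>
      have "{\<sigma>. \<sigma> \<in> ?Fix \<and> c \<sigma> = \<alpha>} = {\<sigma> \<in> X \<alpha>. g ` \<sigma> = \<sigma>}" by (auto simp: X_def)
      then show "(\<Sum>\<sigma> | \<sigma> \<in> ?Fix \<and> c \<sigma> = \<alpha>. M_qsym (c \<sigma>) m) = f \<alpha> g * M_qsym \<alpha> m"
        by (simp add: f_def X_def)
    qed
    finally show "flag_qsym \<Phi> \<kappa> d g m = (\<Sum>\<alpha> | composition \<alpha> \<and> f \<alpha> g \<noteq> 0. f \<alpha> g * M_qsym \<alpha> m)"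
      unfolding support .
  qed
  \<comment> \<open>By \<open>F\<close>, the series at \<open>g\<close> depends on \<open>g\<close>
    only through the values \<open>f \<alpha> g\<close>, which are invariant under
    conjugation.\<close>
  have "class_function G (flag_qsym \<Phi> \<kappa> d)"
    using f_class unfolding class_function_def F by simp
  moreover have "quasisymmetric (flag_qsym \<Phi> \<kappa> d g)" for g
    unfolding flag by (intro quasisymmetric_sum quasisymmetric_M_qsym c(1)) simp
  ultimately have qsym: "qsym_class_function G (flag_qsym \<Phi> \<kappa> d)"
    by (simp add: qsym_class_function_def)

  \<comment> \<open>Effectiveness and monotonicity of the coefficients\<close>
  have f_effective: "effective G (f \<alpha>)" for \<alpha>
    using effective_fixed_points_diff[where D = "{}" and Y = "{}" and act = "(`)", OF G X X_act X_one X_mult]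
    by (simp add: f_def[abs_def])
  have "effective G (\<lambda>g. f \<beta> g - f \<alpha> g)"
    if \<alpha>: "composition \<alpha>" and \<beta>: "composition \<beta>" and ref: "refines \<beta> \<alpha>" for \<alpha> \<beta>
  \<comment> \<open>Types of faces have sum \<open>n\<close>, and refinement preserves the sum; for
    any other sum both coefficients are zero.\<close>
  proof (cases "sum_list \<beta> = n")
    case False
    then have "sum_list \<alpha> \<noteq> n" using refines_sum_list[OF ref] by simp
    then have "X \<alpha> = {}" "X \<beta> = {}" using False c(2) by (auto simp: X_def)
    then show ?thesis by (simp add: f_def effective_zero)
  next
    case sum\<beta>: True
    then have sum\<alpha>: "sum_list \<alpha> = n" using refines_sum_list[OF ref] by simp
    define S where "S = partial_sums \<alpha>"
    define T where "T = partial_sums \<beta>"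
    have ST: "S \<subseteq> T" "T \<subseteq> {1..<n}"
      using refines_partial_sums[OF ref] partial_sums_subset[of \<beta>] sum\<beta> by (auto simp: S_def T_def)
    \<comment> \<open>A composition with sum \<open>n\<close> is determined by its partial sums, so
      having type \<open>\<alpha>\<close> amounts to having color set \<open>S\<close>.\<close>
    have X\<alpha>: "X \<alpha> = {\<sigma> \<in> \<Phi>. \<kappa> ` \<sigma> = S}"
      using comp_of_set_partial_sums[OF \<alpha>] sum\<alpha> n c(3)
      unfolding X_def S_def by (intro Collect_cong) (metis c_def)
    have X\<beta>: "X \<beta> = {\<sigma> \<in> \<Phi>. \<kappa> ` \<sigma> = T}"
      using comp_of_set_partial_sums[OF \<beta>] sum\<beta> n c(3)
      unfolding X_def T_def by (intro Collect_cong) (metis c_def)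
    define p where "p \<sigma> = {v \<in> \<sigma>. \<kappa> v \<in> S}" for \<sigma>
    have p_act: "p (g ` \<sigma>) = g ` p \<sigma>" if "g \<in> carrier G" "\<sigma> \<in> \<Phi>" for g \<sigma>
      using \<kappa>_act[OF that] by (auto simp: p_def)
    \<comment> \<open>In a relative complex a subset of a face need not be a face, so
      \<open>p\<close> is restricted to those faces whose part with colors in \<open>S\<close> is
      again a face.\<close>
    define D where "D = {\<sigma> \<in> X \<beta>. p \<sigma> \<in> \<Phi>}"
    have D: "D \<subseteq> X \<beta>" by (auto simp: D_def)
    have D_act: "g ` \<sigma> \<in> D" if "g \<in> carrier G" "\<sigma> \<in> D" for g \<sigma>
      using that X_act act p_act by (simp add: D_def X_def)
    have "\<kappa> ` p \<sigma> = S" if "\<kappa> ` \<sigma> = T" for \<sigma>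
      using that ST(1) by (auto simp: p_def)
    then have "p ` D \<subseteq> X \<alpha>" by (auto simp: D_def X\<alpha> X\<beta>)
    moreover have "X \<alpha> \<subseteq> p ` D"
    proof
      fix \<rho> assume \<rho>: "\<rho> \<in> X \<alpha>"
      then obtain \<sigma> where "\<sigma> \<in> \<Phi>" "\<kappa> ` \<sigma> = T" "p \<sigma> = \<rho>"
        using face_extension[of \<rho> T] ST by (auto simp: X\<alpha> p_def n_def)
      then show "\<rho> \<in> p ` D" using \<rho> by (auto simp: D_def X\<beta> X\<alpha> intro!: image_eqI[of _ _ \<sigma>])
    qed
    ultimately have pD: "p ` D = X \<alpha>" by blast
    have "p (g ` \<sigma>) = g ` p \<sigma>" if "g \<in> carrier G" "\<sigma> \<in> D" for g \<sigma>
      using p_act that by (simp add: D_def X_def)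
    from effective_fixed_points_diff[where act = "(`)" and act' = "(`)",
        OF G X X_act X_one X_mult D D_act pD this]
    show ?thesis by (simp add: f_def)
  qed
  then have "M_increasing G (flag_qsym \<Phi> \<kappa> d)"
    unfolding M_increasing_def character_le_def M_expansion_def
    using f_class fin_support F f_effective by (intro exI[of _ f]) simp
  then show ?thesis using qsym by (simp add: G_def)
qed

end
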